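(* Let $m,n\ge 1$ and let $\mathbf r=(r_1,\dots,r_n)$ be positive real numbers. The space $\widetilde M_{\mathbf r}$ of closed polygons with side-lengths $\mathbf r$ contains a decomposable polygon if and only if $\mathbf r$ lies on a wall.
   Context: For a unit vector $w\in\mathbb C^{m+1}$, $w\otimes w^*$ is the projection $v\mapsto(v,w)w$. For $r>0$, $\mathcal O_r=\{r\,w\otimes w^*:\|w\|=1\}$, a set of $(m+1)\times(m+1)$ Hermitian matrices. $\Lambda=\frac1{m+1}\sum_i r_i$, and $\widetilde M_{\mathbf r}=\{(e_1,\dots,e_n)\in\prod_i\mathcal O_{r_i}:\sum_i e_i=\Lambda\mathbb I\}$. Walls: let $C(n,m+1)$ be the set of $\mathbf r\in(\mathbb R_{>0})^n$ with $\widetilde M_{\mathbf r}\neq\emptyset$ (equivalently $m r_i\le\sum_{j\ne i}r_j$ for all $i$). For $1\le k\le m$ and a partition $\{1,\dots,n\}=I\sqcup J$ into nonempty subsets, the wall $W_{I,J,k}$ is $\{\mathbf r\in C(n,m+1): k\sum_{i\in I}r_i=(m-k+1)\sum_{j\in J}r_j\}$. Decomposable: $\mathbf e\in\widetilde M_{\mathbf r}$ is decomposable if there are $1\le k\le m$, an orthogonal decomposition $\mathbb C^{m+1}=V_1\oplus V_2$ with $\dim V_1=m-k+1$, $\dim V_2=k$, and a partition $\{1,\dots,n\}=I\sqcup J$ into nonempty subsets such that: for $i\in I$, $e_i$ has image in $V_1$ (i.e. $e_i=r_i w_i\otimes w_i^*$ with $w_i\in V_1$); for $j\in J$, $e_j$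 has image in $V_2$; and $(e_i)_{i\in I}$, $(e_j)_{j\in J}$ are closed polygons in $V_1$, $V_2$ respectively, i.e. $\sum_{i\in I}e_i|_{V_1}$ is a scalar multiple of $\mathrm{id}_{V_1}$ and $\sum_{j\in J}e_j|_{V_2}$ is a scalar multiple of $\mathrm{id}_{V_2}$. *)

theory Defs
  imports "HOL-Analysis.Analysis"
begin

text \<open>
  Throughout, \<open>'d\<close> is the index type of the coordinates of the ambient Hermitian space, so
  that \<open>CARD('d)\<close> plays the role of $m+1$ and \<open>complex ^ 'd\<close> that of $C^{m+1}$; \<open>'n\<close> is the
  index type of the edges of a polygon. Complex-linear notions (subspace, dimension) are the
  \<open>vec.\<close>-qualified ones; the unqualified ones are real-linear.
\<close>

definition hinner :: "complex ^ 'd \<Rightarrow> complex ^ 'd \<Rightarrow> complex" where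
  "hinner v w = (\<Sum>a\<in>UNIV. v $ a * cnj (w $ a))"

lemma hinner_self: "hinner w w = of_real ((norm w)\<^sup>2)"
  by (simp add: hinner_def norm_vec_def L2_set_def sum_nonneg
      flip: complex_norm_square)

definition rank_one :: "complex ^ 'd \<Rightarrow> complex ^ 'd ^ 'd" where
  "rank_one w = (\<chi> a b. w $ a * cnj (w $ b))"

lemma rank_one_apply: "rank_one w *v v = hinner v w *s w"
  by (simp add: vec_eq_iff rank_one_def hinner_def matrix_vector_mult_def
      sum_distrib_left sum_distrib_right mult_ac)

definition orbit :: "real \<Rightarrow> (complex ^ 'd ^ 'd) set" where
  "orbit \<rho> = {\<rho> *\<^sub>R rank_one w | w. norm w = 1}"

definition closed_polygons :: "real ^ 'n \<Rightarrow> (complex ^ 'd ^ 'd ^ 'n) set" where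
  "closed_polygons r =
    {e. (\<forall>i. e $ i \<in> orbit (r $ i)) \<and>
        (\<Sum>i\<in>UNIV. e $ i) = mat (of_real ((\<Sum>i\<in>UNIV. r $ i) / real CARD('d)))}"

definition bipartition :: "'n set \<Rightarrow> 'n set \<Rightarrow> bool" where
  "bipartition I J \<longleftrightarrow> I \<noteq> {} \<and> J \<noteq> {} \<and> I \<inter> J = {} \<and> I \<union> J = UNIV"

definition weight_cone :: "'d::finite itself \<Rightarrow> (real ^ 'n) set" where
  "weight_cone _ = {r. (\<forall>i. r $ i > 0) \<and> (closed_polygons r :: (complex ^ 'd ^ 'd ^ 'n) set) \<noteq> {}}"

definition wall :: "'d::finite itself \<Rightarrow> 'n set \<Rightarrow> 'n set \<Rightarrow> nat \<Rightarrow> (real ^ 'n) set" where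
  "wall d I J k =
    {r \<in> weight_cone d. real k * (\<Sum>i\<in>I. r $ i) = real (CARD('d) - k) * (\<Sum>j\<in>J. r $ j)}"

definition orthogonal_decomposition :: "(complex ^ 'd) set \<Rightarrow> (complex ^ 'd) set \<Rightarrow> bool" where
  "orthogonal_decomposition V1 V2 \<longleftrightarrow>
    vec.subspace V1 \<and> vec.subspace V2 \<and>
    (\<forall>x\<in>V1. \<forall>y\<in>V2. hinner x y = 0) \<and> (\<forall>v. \<exists>x\<in>V1. \<exists>y\<in>V2. v = x + y)"

definition closed_in ::
    "(complex ^ 'd) set \<Rightarrow> 'n set \<Rightarrow> complex ^ 'd ^ 'd ^ 'n \<Rightarrow> bool" where
  "closed_in V I e \<longleftrightarrow>
    (\<forall>i\<in>I. range ((*v) (e $ i)) \<subseteq> V) \<and> (\<exists>c. \<forall>v\<in>V. (\<Sum>i\<in>I. e $ i *v v) = c *s v)"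

text \<open>This is only meant for \<open>e\<close> in some \<open>closed_polygons r\<close>.\<close>

definition decomposable :: "complex ^ 'd ^ 'd ^ 'n \<Rightarrow> bool" where
  "decomposable e \<longleftrightarrow>
    (\<exists>k V1 V2 I J. 1 \<le> k \<and> k < CARD('d) \<and>
      orthogonal_decomposition V1 V2 \<and> vec.dim V1 = CARD('d) - k \<and> vec.dim V2 = k \<and>
      bipartition I J \<and> closed_in V1 I e \<and> closed_in V2 J e)"

end

theory Submission
  imports Defs
begin

text \<open>
  If a polygon decomposes along $V_1 \oplus V_2$, then the partial sum of the edges over \<open>I\<close>
  is $\Lambda$ times the projection onto $V_1$; comparing traces gives
  $\sum_{i \in I} r_i = \Lambda \dim V_1$, and likewise for \<open>J\<close>. Conversely, on a wall the
  numbers $r_i / \Lambda$ lie in $[0,1]$ and have integral sums over \<open>I\<close> and over \<open>J\<close>. They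
  are therefore the squared norms of Parseval frames of complementary coordinate subspaces: start
  from an orthonormal basis padded with zeros and rotate pairs of vectors, which changes their
  norms continuously but not the sum of their rank-one operators.
\<close>

section \<open>Coordinate projections, rank-one matrices and the Hermitian form\<close>

definition coord_proj :: "'d set \<Rightarrow> complex ^ 'd ^ 'd" where
  "coord_proj S = (\<chi> a b. if a = b \<and> a \<in> S then 1 else 0)"

lemma coord_proj_apply: "(coord_proj S *v v) $ a = (if a \<in> S then v $ a else 0)"
proof -
  have "(coord_proj S *v v) $ a = (\<Sum>b\<in>UNIV. if a = b then (if a \<in> S then v $ b else 0) else 0)"
    unfolding coord_proj_def matrix_vector_mult_def vec_lambda_beta by (rule sum.cong) auto
  then show ?thesis by simp
qed

lemma trace_rank_one: "trace (rank_one w) = of_real ((norm w)\<^sup>2)"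
  unfolding trace_def rank_one_def hinner_self[symmetric] hinner_def by simp

lemma trace_scaleR: "trace (c *\<^sub>R (A :: complex ^ 'd ^ 'd)) = of_real c * trace A"
  by (simp add: trace_def scaleR_conv_of_real[where 'a = complex] sum_distrib_left)

lemma rank_one_scaleR: "rank_one (c *\<^sub>R w) = c\<^sup>2 *\<^sub>R rank_one w"
  by (simp add: rank_one_def vec_eq_iff power2_eq_square)

lemma scaleR_matrix_vector_mult: "(c *\<^sub>R A) *v (v :: complex ^ 'd) = c *\<^sub>R (A *v v)"
  by (simp add: vec_eq_iff matrix_vector_mult_def scaleR_sum_right)

lemma sum_matrix_vector_mult: "sum A I *v (v :: complex ^ 'd) = (\<Sum>i\<in>I. A i *v v)"
  by (induction I rule: infinite_finite_induct) (simp_all add: matrix_vector_mult_add_rdistrib)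

lemma hinner_scaleR_left: "hinner (c *\<^sub>R v) w = of_real c * hinner v w"
  by (simp add: hinner_def sum_distrib_left scaleR_conv_of_real[where 'a = complex] mult.assoc)

lemma hinner_scale_left: "hinner (c *s v) w = c * hinner v w"
  by (simp add: hinner_def sum_distrib_left mult.assoc)

lemma hinner_sum_left: "hinner (sum f I) w = (\<Sum>i\<in>I. hinner (f i) w)"
  unfolding hinner_def by (simp add: sum_distrib_right) (rule sum.swap)

lemma hinner_commute: "hinner v w = cnj (hinner w v)"
  by (simp add: hinner_def mult.commute)

section \<open>Parseval frames with prescribed norms\<close>

text \<open>A real rotation mixing \<open>x\<close> and \<open>y\<close> is unitary on the pair and
  so preserves the sum of the two rank-one matrices. Along a quarter turn the squared norm of the
  first vector moves continuously from that of \<open>x\<close> to that of \<open>y\<close>, hence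
  passes through \<open>t\<close>.\<close>

lemma rotate_pair:
  fixes x y :: "complex ^ 'd"
  assumes "(norm y)\<^sup>2 \<le> t" and "t \<le> (norm x)\<^sup>2"
  obtains x' y' where "rank_one x' + rank_one y' = rank_one x + rank_one y"
    and "(norm x')\<^sup>2 = t" and "(norm y')\<^sup>2 = (norm x)\<^sup>2 + (norm y)\<^sup>2 - t"
proof -
  define f where "f \<theta> = cos \<theta> *\<^sub>R x + sin \<theta> *\<^sub>R y" for \<theta> :: real
  define g where "g \<theta> = cos \<theta> *\<^sub>R y - sin \<theta> *\<^sub>R x" for \<theta> :: real
  have "\<exists>\<theta>\<ge>0. \<theta> \<le> pi / 2 \<and> (norm (f \<theta>))\<^sup>2 = t"
    by (rule IVT2') (use assms in \<open>auto simp: f_def intro!: continuous_intros\<close>)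
  then obtain \<theta> where t: "(norm (f \<theta>))\<^sup>2 = t" by blast
  have eq: "rank_one (f \<theta>) + rank_one (g \<theta>) = rank_one x + rank_one y"
  proof -
    \<comment> \<open>Each matrix entry is an instance of this identity: \<open>p\<close>,
      \<open>q\<close> are the row entries of \<open>x\<close>, \<open>y\<close>, and
      \<open>p'\<close>, \<open>q'\<close> the conjugated column entries.\<close>
    have "(c * p + s * q) * (c * p' + s * q') + (c * q - s * p) * (c * q' - s * p') = p * p' + q * q'"
      if "c\<^sup>2 + s\<^sup>2 = 1" for c s p q p' q' :: complex
    proof -
      have "(c * p + s * q) * (c * p' + s * q') + (c * q - s * p) * (c * q' - s * p')
        = (c\<^sup>2 + s\<^sup>2) * (p * p' + q * q')"
        by (simp add: algebra_simps power2_eq_square)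
      with that show ?thesis by simp
    qed
    moreover have "(of_real (cos \<theta>))\<^sup>2 + (of_real (sin \<theta>))\<^sup>2 = (1 :: complex)"
      by (metis of_real_1 of_real_add of_real_power sin_cos_squared_add2)
    ultimately show ?thesis
      by (simp add: vec_eq_iff rank_one_def f_def g_def scaleR_conv_of_real[where 'a = complex])
  qed
  \<comment> \<open>The trace of a rank-one matrix is a squared norm, so the preserved sum also
    fixes the norm of the second vector.\<close>
  have "trace (rank_one (f \<theta>)) + trace (rank_one (g \<theta>)) = trace (rank_one x) + trace (rank_one y)"
    using eq by (metis trace_add)
  then have "(norm (f \<theta>))\<^sup>2 + (norm (g \<theta>))\<^sup>2 = (norm x)\<^sup>2 + (norm y)\<^sup>2"
    unfolding trace_rank_one by (metis of_real_add of_real_eq_iff)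
  with t eq show ?thesis by (intro that[of "f \<theta>" "g \<theta>"]) auto
qed

text \<open>If all other values were 0 or 1, then \<open>a i\<close> would be a difference of
  integers, yet it lies strictly between 0 and 1. This supplies the partner for a rotation.\<close>

lemma two_fractional:
  fixes a :: "'i \<Rightarrow> real"
  assumes "finite I" and "\<And>i. i \<in> I \<Longrightarrow> 0 \<le> a i \<and> a i \<le> 1" and "sum a I = real p"
    and "i \<in> I" and "0 < a i" and "a i < 1"
  obtains j where "j \<in> I" and "j \<noteq> i" and "0 < a j" and "a j < 1"
proof (rule ccontr)
  assume "\<not> thesis"
  with that assms(2) have *: "a j = 0 \<or> a j = 1" if "j \<in> I - {i}" for j
    using that by fastforce
  then have "sum a (I - {i}) \<in> \<int>"
    by (intro Ints_sum) fastforce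
  moreover have "a i = real p - sum a (I - {i})"
    using assms by (simp add: sum.remove)
  ultimately have "a i \<in> \<int>" by (metis Ints_diff Ints_of_nat)
  then obtain z where "a i = of_int z" by (auto elim: Ints_cases)
  with assms show False by simp
qed

text \<open>Induction on the number of prescribed values strictly between 0 and 1. Shifting mass
  between two such values until one of them becomes integral gives an instance with fewer of them; a
  rotation of the two corresponding vectors in its solution restores the original values.\<close>

lemma parseval_frame_exists:
  fixes a :: "'i \<Rightarrow> real" and S :: "'d::finite set"
  assumes "finite I" and "\<And>i. i \<in> I \<Longrightarrow> 0 \<le> a i \<and> a i \<le> 1" and "sum a I = real (card S)"
  shows "\<exists>x. (\<forall>i\<in>I. (norm (x i))\<^sup>2 = a i) \<and> (\<Sum>i\<in>I. rank_one (x i)) = coord_proj S"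
  using assms(2,3)
proof (induction "card {i \<in> I. 0 < a i \<and> a i < 1}" arbitrary: a rule: less_induct)
  case less
  show ?case
  proof (cases "\<exists>i\<in>I. 0 < a i \<and> a i < 1")
    case False
    define T where "T = {i \<in> I. a i = 1}"
    have a: "a i = (if i \<in> T then 1 else 0)" if "i \<in> I" for i
      using False less.prems(1)[OF that] that by (force simp: T_def)
    have "sum a I = (\<Sum>i\<in>I. if i \<in> T then 1 else 0)" by (rule sum.cong) (auto simp: a)
    also have "\<dots> = real (card T)"
      using \<open>finite I\<close> by (simp add: sum.If_cases T_def Int_def)
    finally have "card T = card S" using less.prems(2) by simp
    \<comment> \<open>All values are 0 or 1 here, and as many are 1 as \<open>S\<close> has
      elements: the indices in \<open>T\<close> receive the standard basis vectors of
      \<open>S\<close>, all others the zero vector.\<close>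
    then obtain h where h: "bij_betw h T S"
      using \<open>finite I\<close> by (metis T_def finite finite_Collect_conjI finite_same_card_bij Collect_mem_eq)
    define x :: "'i \<Rightarrow> complex ^ 'd" where "x i = (if i \<in> T then axis (h i) 1 else 0)" for i
    have "(\<Sum>i\<in>I. rank_one (x i)) = (\<Sum>i\<in>T. rank_one (axis (h i) 1))"
      using \<open>finite I\<close> by (intro sum.mono_neutral_cong_right)
        (auto simp: T_def x_def rank_one_def vec_eq_iff)
    also have "\<dots> = (\<Sum>s\<in>S. rank_one (axis s 1))"
      by (rule sum.reindex_bij_betw[OF h])
    also have "\<dots> = coord_proj S"
    proof -
      have "(\<Sum>s\<in>S. axis s (1::complex) $ p * cnj (axis s 1 $ q)) = (if p = q \<and> p \<in> S then 1 else 0)"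
        for p q
      proof -
        have "(\<Sum>s\<in>S. axis s (1::complex) $ p * cnj (axis s 1 $ q))
          = (\<Sum>s\<in>S. if s = p then (if p = q then 1 else 0) else 0)"
          by (rule sum.cong) (auto simp: axis_def)
        then show ?thesis by simp
      qed
      then show ?thesis by (simp add: vec_eq_iff rank_one_def coord_proj_def)
    qed
    finally show ?thesis
      by (intro exI[of _ x]) (auto simp: a x_def norm_axis_1)
  next
    case True
    then obtain i where i: "i \<in> I" "0 < a i" "a i < 1" by blast
    obtain j where j: "j \<in> I" "j \<noteq> i" "0 < a j" "a j < 1"
      using two_fractional[OF \<open>finite I\<close> less.prems i] by blast
    \<comment> \<open>As much mass as possible goes from \<open>j\<close> to \<open>i\<close>:
      either \<open>i\<close> reaches 1 or \<open>j\<close> drops to 0. In both cases the total is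
      unchanged.\<close>
    define u where "u = min 1 (a i + a j)"
    define b where "b = a(i := u, j := a i + a j - u)"
    have b: "b i = u" "b j = a i + a j - u" "\<And>l. l \<noteq> i \<Longrightarrow> l \<noteq> j \<Longrightarrow> b l = a l"
      using j(2) by (auto simp: b_def)
    \<comment> \<open>The general codomain allows use both for real values and for matrices.\<close>
    have split: "sum F I = F i + F j + sum F (I - {i, j})" for F :: "'i \<Rightarrow> 'b::ab_group_add"
    proof -
      have "I = insert i (insert j (I - {i, j}))" using i j by auto
      then have "sum F I = sum F (insert i (insert j (I - {i, j})))" by simp
      then show ?thesis using \<open>finite I\<close> j(2) by (simp add: add.assoc)
    qed
    have rest: "sum b (I - {i, j}) = sum a (I - {i, j})" by (rule sum.cong) (auto simp: b)
    have bounds: "0 \<le> b l \<and> b l \<le> 1" if "l \<in> I" for l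
      using less.prems(1)[OF that] i j by (cases "l = i"; cases "l = j") (auto simp: b u_def)
    have "{l \<in> I. 0 < b l \<and> b l < 1} \<subset> {l \<in> I. 0 < a l \<and> a l < 1}"
    proof
      show "{l \<in> I. 0 < b l \<and> b l < 1} \<subseteq> {l \<in> I. 0 < a l \<and> a l < 1}"
      proof
        fix l assume "l \<in> {l \<in> I. 0 < b l \<and> b l < 1}"
        then show "l \<in> {l \<in> I. 0 < a l \<and> a l < 1}"
          using i j by (cases "l = i"; cases "l = j") (auto simp: b)
      qed
      have "i \<notin> {l \<in> I. 0 < b l \<and> b l < 1} \<or> j \<notin> {l \<in> I. 0 < b l \<and> b l < 1}"
        by (auto simp: b u_def)
      then show "{l \<in> I. 0 < b l \<and> b l < 1} \<noteq> {l \<in> I. 0 < a l \<and> a l < 1}"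
        using i j by blast
    qed
    then have "card {l \<in> I. 0 < b l \<and> b l < 1} < card {l \<in> I. 0 < a l \<and> a l < 1}"
      using \<open>finite I\<close> by (intro psubset_card_mono) auto
    moreover have "sum b I = real (card S)"
      using less.prems(2) split[of a] split[of b] rest b by simp
    ultimately have "\<exists>x. (\<forall>l\<in>I. (norm (x l))\<^sup>2 = b l) \<and>
        (\<Sum>l\<in>I. rank_one (x l)) = (coord_proj S :: complex ^ 'd ^ 'd)"
      by (intro less.hyps bounds)
    then obtain x where x: "\<And>l. l \<in> I \<Longrightarrow> (norm (x l))\<^sup>2 = b l"
      and sum_x: "(\<Sum>l\<in>I. rank_one (x l)) = (coord_proj S :: complex ^ 'd ^ 'd)"
      by blast
    \<comment> \<open>The shift only spread the two values apart: \<open>b j\<close> \<le>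
      \<open>a i\<close> \<le> \<open>b i\<close>. Hence \<open>a i\<close> is a norm that rotating
      \<open>x i\<close> towards \<open>x j\<close> attains, and the preserved sum leaves
      \<open>a j\<close> for the other vector.\<close>
    have "(norm (x j))\<^sup>2 \<le> a i" "a i \<le> (norm (x i))\<^sup>2"
      using i j by (auto simp: x b u_def)
    then obtain y z where yz: "rank_one y + rank_one z = rank_one (x i) + rank_one (x j)"
      "(norm y)\<^sup>2 = a i" "(norm z)\<^sup>2 = (norm (x i))\<^sup>2 + (norm (x j))\<^sup>2 - a i"
      by (rule rotate_pair)
    define x' where "x' = x(i := y, j := z)"
    have x': "x' i = y" "x' j = z" "\<And>l. l \<noteq> i \<Longrightarrow> l \<noteq> j \<Longrightarrow> x' l = x l"
      using j(2) by (auto simp: x'_def)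
    have "(\<Sum>l\<in>I - {i, j}. rank_one (x' l)) = (\<Sum>l\<in>I - {i, j}. rank_one (x l))"
      by (rule sum.cong) (auto simp: x')
    then have "(\<Sum>l\<in>I. rank_one (x' l)) = coord_proj S"
      using sum_x split[of "\<lambda>l. rank_one (x' l)"] split[of "\<lambda>l. rank_one (x l)"] yz(1)
      by (simp add: x')
    moreover have "(norm (x' l))\<^sup>2 = a l" if "l \<in> I" for l
      using that i j yz by (cases "l = i"; cases "l = j") (auto simp: x x' b)
    ultimately show ?thesis by blast
  qed
qed

section \<open>Frames of coordinate subspaces as closed polygons\<close>

text \<open>The diagonal entry of the frame sum at \<open>a\<close> is a sum of squared moduli;
  since it vanishes, each of them does.\<close>

lemma frame_support:
  fixes x :: "'i \<Rightarrow> complex ^ 'd"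
  assumes "finite I" and "(\<Sum>i\<in>I. rank_one (x i)) = coord_proj S" and "i \<in> I" and "a \<notin> S"
  shows "x i $ a = 0"
proof -
  have "(\<Sum>i\<in>I. rank_one (x i)) $ a $ a = 0"
    using assms by (simp add: coord_proj_def)
  then have "(\<Sum>i\<in>I. complex_of_real ((cmod (x i $ a))\<^sup>2)) = 0"
    by (simp add: rank_one_def complex_norm_square del: of_real_power)
  then have "(\<Sum>i\<in>I. (cmod (x i $ a))\<^sup>2) = 0"
    by (metis of_real_sum of_real_eq_0_iff)
  then show ?thesis
    using assms by (simp add: sum_nonneg_eq_0_iff)
qed

text \<open>The images lie in the subspace by \<open>frame_support\<close>, and the projection acts
  on it as the identity, so the closing scalar is \<open>c\<close>.\<close>

lemma closed_in_coordinate_subspace: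
  fixes x :: "'i::finite \<Rightarrow> complex ^ 'd"
  assumes "(\<Sum>i\<in>I. rank_one (x i)) = coord_proj S" and "\<And>i. i \<in> I \<Longrightarrow> e $ i = c *\<^sub>R rank_one (x i)"
  shows "closed_in {v. \<forall>a. a \<notin> S \<longrightarrow> v $ a = 0} I e"
  unfolding closed_in_def
proof (intro conjI ballI exI)
  fix i assume "i \<in> I"
  with assms show "range ((*v) (e $ i)) \<subseteq> {v. \<forall>a. a \<notin> S \<longrightarrow> v $ a = 0}"
    using frame_support[OF _ assms(1)] by (auto simp: scaleR_matrix_vector_mult rank_one_apply)
next
  fix v :: "complex ^ 'd"
  assume "v \<in> {v. \<forall>a. a \<notin> S \<longrightarrow> v $ a = 0}"
  then have "coord_proj S *v v = v" by (auto simp: vec_eq_iff coord_proj_apply)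
  moreover have "(\<Sum>i\<in>I. e $ i *v v) = c *\<^sub>R (coord_proj S *v v)"
    using assms by (simp add: scaleR_matrix_vector_mult sum_matrix_vector_mult scaleR_sum_right flip: assms(1))
  ultimately show "(\<Sum>i\<in>I. e $ i *v v) = of_real c *s v"
    by (simp add: vec_eq_iff scaleR_conv_of_real[where 'a = complex])
qed

section \<open>The trace of an operator that is scalar on one summand and zero on the other\<close>

text \<open>Bases of \<open>V1\<close> and \<open>V2\<close> together form a basis of eigenvectors,
  in which \<open>A\<close> is diagonal with \<open>c\<close> on the part coming from
  \<open>V1\<close>. Trace is invariant under this change of basis.\<close>

lemma trace_scalar_on_summand:
  fixes A :: "complex ^ 'd ^ 'd"
  assumes "vec.subspace V1" "vec.subspace V2" "V1 \<inter> V2 \<subseteq> {0}" "\<And>v. \<exists>x\<in>V1. \<exists>y\<in>V2. v = x + y"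
    and on_V1: "\<And>v. v \<in> V1 \<Longrightarrow> A *v v = c *s v" and on_V2: "\<And>v. v \<in> V2 \<Longrightarrow> A *v v = 0"
  shows "trace A = c * of_nat (vec.dim V1)"
proof -
  obtain B1 where B1: "B1 \<subseteq> V1" "vec.independent B1" "V1 \<subseteq> vec.span B1" "card B1 = vec.dim V1"
    using vec.basis_exists by blast
  obtain B2 where B2: "B2 \<subseteq> V2" "vec.independent B2" "V2 \<subseteq> vec.span B2" "card B2 = vec.dim V2"
    using vec.basis_exists by blast
  have fin: "finite B1" "finite B2"
    using B1 B2 vec.finiteI_independent by blast+
  have "0 \<notin> B1" using B1 vec.dependent_zero by blast
  then have disj: "B1 \<inter> B2 = {}" using B1 B2 assms(3) by blast
  have spanning: "vec.span (B1 \<union> B2) = UNIV"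
  proof -
    have "v \<in> vec.span (B1 \<union> B2)" for v
    proof -
      obtain x y where "x \<in> V1" "y \<in> V2" "v = x + y" using assms(4) by blast
      moreover have "vec.span B1 \<subseteq> vec.span (B1 \<union> B2)" "vec.span B2 \<subseteq> vec.span (B1 \<union> B2)"
        by (simp_all add: vec.span_mono)
      ultimately show ?thesis using B1 B2 by (meson subsetD vec.span_add)
    qed
    then show ?thesis by blast
  qed
  have "vec.dim V1 + vec.dim V2 = CARD('d)"
  proof -
    have "V1 \<inter> V2 = {0}" using assms(1-3) vec.subspace_0 by blast
    moreover have "{x + y |x y. x \<in> V1 \<and> y \<in> V2} = UNIV" using assms(4) by blast
    ultimately show ?thesis
      using vec.dim_sums_Int[OF assms(1,2)] by (simp add: vec_dim_card del: vec.dim_UNIV)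
  qed
  \<comment> \<open>With exactly this many elements the joint basis can be indexed by
    \<open>'d\<close> itself and becomes the columns of a square matrix \<open>P\<close>.\<close>
  then have "card (B1 \<union> B2) = CARD('d)"
    using fin disj B1 B2 by (simp add: card_Un_disjoint)
  then obtain f :: "'d \<Rightarrow> _" where f: "bij_betw f UNIV (B1 \<union> B2)"
    using fin finite_same_card_bij[of "UNIV :: 'd set" "B1 \<union> B2"] by auto
  define P :: "complex ^ 'd ^ 'd" where "P = (\<chi> a j. f j $ a)"
  define D :: "complex ^ 'd ^ 'd" where "D = (\<chi> i j. if i = j \<and> f j \<in> B1 then c else 0)"
  have col: "column j P = f j" for j by (simp add: column_def P_def vec_eq_iff)
  then have "columns P = range f" by (auto simp: columns_def)
  \<comment> \<open>Spanning columns yield a right inverse of \<open>P\<close>; as \<open>P\<close>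
    is square, it is a left inverse too, which the cyclic trace argument below needs.\<close>
  then have "vec.span (columns P) = UNIV"
    using f spanning by (simp add: bij_betw_imp_surj_on)
  then obtain Q where Q: "P ** Q = mat 1"
    using matrix_right_invertible_span_columns by blast
  have "A ** P = P ** D"
  proof -
    have "(A ** P) $ a $ j = (P ** D) $ a $ j" for a j
    proof -
      have "f j \<in> B1 \<union> B2" using f by (auto simp: bij_betw_def)
      then have "A *v f j = (if f j \<in> B1 then c else 0) *s f j"
        using on_V1[of "f j"] on_V2[of "f j"] B1 B2 by auto
      moreover have "(A ** P) $ a $ j = (A *v f j) $ a"
        by (simp add: matrix_matrix_mult_def matrix_vector_mult_def P_def)
      moreover have "(P ** D) $ a $ j = (\<Sum>k\<in>UNIV. if k = j then f j $ a * (if f j \<in> B1 then c else 0) else 0)"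
        unfolding matrix_matrix_mult_def P_def D_def vec_lambda_beta by (rule sum.cong) auto
      ultimately show ?thesis by simp
    qed
    then show ?thesis by (simp add: vec_eq_iff)
  qed
  then have "A = P ** D ** Q"
    using Q by (metis matrix_mul_assoc matrix_mul_rid)
  then have "trace A = trace (Q ** P ** D)"
    by (metis trace_mul_sym matrix_mul_assoc)
  also have "\<dots> = trace D" using Q by (metis matrix_left_right_inverse matrix_mul_lid)
  also have "\<dots> = (\<Sum>j\<in>UNIV. if f j \<in> B1 then c else 0)" by (simp add: trace_def D_def)
  also have "\<dots> = (\<Sum>b\<in>B1 \<union> B2. if b \<in> B1 then c else 0)"
    by (rule sum.reindex_bij_betw[OF f])
  also have "\<dots> = (\<Sum>b\<in>B1. c)"
    using fin by (intro sum.mono_neutral_cong_right) auto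
  finally show ?thesis using B1 by (simp add: mult.commute)
qed

section \<open>Side lengths of closed and of decomposable polygons\<close>

lemma closed_polygon_orbit:
  assumes "e \<in> closed_polygons r"
  obtains w where "\<And>i. norm (w i) = 1" and "\<And>i. e $ i = (r $ i) *\<^sub>R rank_one (w i)"
proof -
  have "\<forall>i. \<exists>w. norm w = 1 \<and> e $ i = (r $ i) *\<^sub>R rank_one w"
    using assms by (auto simp: closed_polygons_def orbit_def)
  with that show ?thesis by metis
qed

lemma mat_vector_mult: "mat c *v (v :: complex ^ 'd) = c *s v"
proof -
  have "(mat c *v v) $ a = (\<Sum>b\<in>UNIV. if a = b then c * v $ b else 0)" for a
    unfolding matrix_vector_mult_def mat_def vec_lambda_beta by (rule sum.cong) auto
  then show ?thesis by (simp add: vec_eq_iff)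
qed

lemma closed_polygon_apply:
  fixes e :: "complex ^ 'd ^ 'd ^ 'n"
  assumes "e \<in> closed_polygons r"
  shows "(\<Sum>i\<in>UNIV. e $ i *v v) = of_real ((\<Sum>i\<in>UNIV. r $ i) / real CARD('d)) *s v"
  using assms by (simp add: closed_polygons_def mat_vector_mult flip: sum_matrix_vector_mult)

text \<open>Evaluating the quadratic form of the closing condition at the unit vector
  \<open>w i\<close> writes \<Lambda> as a sum of nonnegative terms, the one at \<open>i\<close>
  being \<open>r $ i\<close>. This provides the upper bound 1 on the prescribed norms of the
  frames.\<close>

lemma side_length_le:
  fixes e :: "complex ^ 'd ^ 'd ^ 'n"
  assumes "e \<in> closed_polygons r" and "\<And>i. r $ i > 0"
  shows "r $ i \<le> (\<Sum>i\<in>UNIV. r $ i) / real CARD('d)"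
proof -
  obtain w where w: "\<And>i. norm (w i) = 1" "\<And>i. e $ i = (r $ i) *\<^sub>R rank_one (w i)"
    by (rule closed_polygon_orbit[OF assms(1)]) (rule that)
  let ?L = "(\<Sum>i\<in>UNIV. r $ i) / real CARD('d)"
  have "hinner (e $ j *v w i) (w i) = of_real (r $ j * (cmod (hinner (w i) (w j)))\<^sup>2)" for j
    by (simp add: w scaleR_matrix_vector_mult rank_one_apply hinner_scaleR_left hinner_scale_left
        hinner_commute[of "w j" "w i"] complex_norm_square del: of_real_power)
  then have "of_real (\<Sum>j\<in>UNIV. r $ j * (cmod (hinner (w i) (w j)))\<^sup>2)
      = hinner (\<Sum>j\<in>UNIV. e $ j *v w i) (w i)"
    by (simp add: hinner_sum_left)
  also have "\<dots> = of_real ?L"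
    unfolding closed_polygon_apply[OF assms(1)] hinner_scale_left hinner_self by (simp add: w(1))
  finally have "(\<Sum>j\<in>UNIV. r $ j * (cmod (hinner (w i) (w j)))\<^sup>2) = ?L"
    by (simp only: of_real_eq_iff)
  moreover have "r $ i * (cmod (hinner (w i) (w i)))\<^sup>2
      \<le> (\<Sum>j\<in>UNIV. r $ j * (cmod (hinner (w i) (w j)))\<^sup>2)"
    by (rule member_le_sum) (use assms(2) in \<open>auto simp: less_imp_le\<close>)
  ultimately show ?thesis by (simp add: hinner_self w)
qed

text \<open>By orthogonality the edges over \<open>J\<close> vanish on \<open>V1\<close> and those
  over \<open>I\<close> vanish on \<open>V2\<close>. The closing condition of the whole polygon
  therefore makes the partial sum over \<open>I\<close> equal to \<Lambda> on \<open>V1\<close> and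
  0 on \<open>V2\<close>; its trace is computed in two ways.\<close>

lemma closed_in_sum_lengths:
  fixes e :: "complex ^ 'd ^ 'd ^ 'n"
  assumes e: "e \<in> closed_polygons r" and r: "\<And>i. r $ i > 0"
    and dec: "orthogonal_decomposition V1 V2" and part: "bipartition I J"
    and cl: "closed_in V1 I e" "closed_in V2 J e" and dim: "vec.dim V1 > 0"
  shows "(\<Sum>i\<in>I. r $ i) = (\<Sum>i\<in>UNIV. r $ i) / real CARD('d) * real (vec.dim V1)"
proof -
  let ?L = "(\<Sum>i\<in>UNIV. r $ i) / real CARD('d)"
  obtain w where w: "\<And>i. norm (w i) = 1" "\<And>i. e $ i = (r $ i) *\<^sub>R rank_one (w i)"
    by (rule closed_polygon_orbit[OF e]) (rule that)
  note V = dec[unfolded orthogonal_decomposition_def]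
  \<comment> \<open>The vector \<open>w i\<close> is an eigenvector of \<open>e $ i\<close> with
    nonzero eigenvalue \<open>r $ i\<close>, so it lies in the image of that edge.\<close>
  have w_mem: "w i \<in> W" if "closed_in W K e" "i \<in> K" "vec.subspace W" for i W K
  proof -
    have "e $ i *v w i = of_real (r $ i) *s w i"
      by (simp add: w scaleR_matrix_vector_mult rank_one_apply hinner_self)
        (simp add: vec_eq_iff scaleR_conv_of_real[where 'a = complex])
    moreover have "e $ i *v w i \<in> W"
      using that(1,2) by (auto simp: closed_in_def)
    ultimately have "of_real (r $ i) *s w i \<in> W" by simp
    then have "inverse (of_real (r $ i)) *s (of_real (r $ i) *s w i) \<in> W"
      using that(3) vec.subspace_scale by blast
    then show ?thesis using r[of i] by simp
  qed
  have kill: "e $ i *v v = 0" if "hinner v (w i) = 0" for i v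
    using that by (simp add: w scaleR_matrix_vector_mult rank_one_apply)
  have on_V1: "(\<Sum>i\<in>I. e $ i) *v v = of_real ?L *s v" if "v \<in> V1" for v
  proof -
    have "(\<Sum>j\<in>J. e $ j *v v) = 0"
      using V that w_mem[OF cl(2)] by (intro sum.neutral) (auto intro: kill)
    moreover have "(\<Sum>i\<in>UNIV. e $ i *v v) = (\<Sum>i\<in>I. e $ i *v v) + (\<Sum>j\<in>J. e $ j *v v)"
      using part by (metis bipartition_def finite sum.union_disjoint)
    ultimately show ?thesis
      by (simp add: closed_polygon_apply[OF e] sum_matrix_vector_mult)
  qed
  have on_V2: "(\<Sum>i\<in>I. e $ i) *v v = 0" if "v \<in> V2" for v
  proof -
    have "hinner v (w i) = 0" if "i \<in> I" for i
      using V \<open>v \<in> V2\<close> w_mem[OF cl(1) that] by (metis hinner_commute complex_cnj_zero)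
    then show ?thesis by (simp add: sum_matrix_vector_mult kill)
  qed
  have "V1 \<inter> V2 \<subseteq> {0}"
  proof
    fix v assume "v \<in> V1 \<inter> V2"
    then have "hinner v v = 0" using V by blast
    then show "v \<in> {0}" by (simp add: hinner_self)
  qed
  then have "trace (\<Sum>i\<in>I. e $ i) = of_real ?L * of_nat (vec.dim V1)"
    using V on_V1 on_V2 by (intro trace_scalar_on_summand[of V1 V2]) auto
  moreover have "trace (\<Sum>i\<in>I. e $ i) = (\<Sum>i\<in>I. trace (e $ i))"
    unfolding trace_def by (simp, rule sum.swap)
  moreover have "(\<Sum>i\<in>I. trace (e $ i)) = of_real (\<Sum>i\<in>I. r $ i)"
    by (simp add: w trace_scaleR trace_rank_one)
  ultimately have "complex_of_real (\<Sum>i\<in>I. r $ i) = of_real (?L * real (vec.dim V1))"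
    by simp
  then show ?thesis by (simp only: of_real_eq_iff)
qed

lemma orthogonal_decomposition_commute:
  "orthogonal_decomposition V1 V2 \<longleftrightarrow> orthogonal_decomposition V2 V1"
  unfolding orthogonal_decomposition_def
  by (metis (no_types, lifting) add.commute hinner_commute complex_cnj_zero)

lemma orthogonal_decomposition_coordinate:
  "orthogonal_decomposition {v. \<forall>a. a \<notin> S \<longrightarrow> v $ a = 0} {v. \<forall>a. a \<notin> - S \<longrightarrow> v $ a = 0}"
proof -
  have "\<exists>x. (\<forall>a. a \<notin> S \<longrightarrow> x $ a = 0) \<and> (\<exists>y. (\<forall>a. a \<in> S \<longrightarrow> y $ a = 0) \<and> v = x + y)"
    for v :: "complex ^ 'a"
    by (rule exI[of _ "\<chi> a. if a \<in> S then v $ a else 0"], rule conjI, simp,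
        rule exI[of _ "\<chi> a. if a \<in> S then 0 else v $ a"]) (simp add: vec_eq_iff)
  moreover have "v $ a * cnj (w $ a) = 0"
    if "\<forall>a. a \<notin> S \<longrightarrow> v $ a = 0" "\<forall>a. a \<in> S \<longrightarrow> w $ a = 0" for v w :: "complex ^ 'a" and a
    using that by (cases "a \<in> S") auto
  ultimately show ?thesis
    by (auto simp: orthogonal_decomposition_def hinner_def vec.subspace_def intro!: sum.neutral)
qed

section \<open>Decomposable polygons and walls\<close>

theorem proposition4p1p6:
  fixes m :: nat and r :: "real ^ 'n"
  assumes "m \<ge> 1" and "CARD('d::finite) = m + 1" and "\<And>i. r $ i > 0"
  shows "(\<exists>e \<in> (closed_polygons r :: (complex ^ 'd ^ 'd ^ 'n) set). decomposable e) \<longleftrightarrow>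
    (\<exists>I J k. bipartition I J \<and> 1 \<le> k \<and> k \<le> m \<and> r \<in> wall TYPE('d) I J k)"
proof
  let ?L = "(\<Sum>i\<in>UNIV. r $ i) / real CARD('d)"
  assume "\<exists>e \<in> (closed_polygons r :: (complex ^ 'd ^ 'd ^ 'n) set). decomposable e"
  then obtain e :: "complex ^ 'd ^ 'd ^ 'n" and k V1 V2 I J where
    e: "e \<in> closed_polygons r" and k: "1 \<le> k" "k < CARD('d)"
    and dec: "orthogonal_decomposition V1 V2" and dim: "vec.dim V1 = CARD('d) - k" "vec.dim V2 = k"
    and part: "bipartition I J" and cl: "closed_in V1 I e" "closed_in V2 J e"
    unfolding decomposable_def by blast
  \<comment> \<open>The length formula applies to both summands, the second time with the roles
    exchanged; eliminating \<Lambda> between the two results gives the wall equation.\<close>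
  have "bipartition J I" using part by (auto simp: bipartition_def)
  then have "(\<Sum>j\<in>J. r $ j) = ?L * real k"
    using closed_in_sum_lengths[OF e assms(3), of V2 V1 J I] dec cl dim k
    by (simp add: orthogonal_decomposition_commute)
  moreover have "(\<Sum>i\<in>I. r $ i) = ?L * real (CARD('d) - k)"
    using closed_in_sum_lengths[OF e assms(3) dec part cl] dim k by simp
  ultimately have "real k * (\<Sum>i\<in>I. r $ i) = real (CARD('d) - k) * (\<Sum>j\<in>J. r $ j)"
    by simp
  then have "r \<in> wall TYPE('d) I J k"
    using e assms(3) by (auto simp: wall_def weight_cone_def)
  then show "\<exists>I J k. bipartition I J \<and> 1 \<le> k \<and> k \<le> m \<and> r \<in> wall TYPE('d) I J k"
    using part k assms(2) by (intro exI[of _ I] exI[of _ J] exI[of _ k]) simp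
next
  define L where "L = (\<Sum>i\<in>UNIV. r $ i) / real CARD('d)"
  assume "\<exists>I J k. bipartition I J \<and> 1 \<le> k \<and> k \<le> m \<and> r \<in> wall TYPE('d) I J k"
  then obtain I J k where part: "bipartition I J" and k: "1 \<le> k" "k \<le> m"
    and wall: "real k * (\<Sum>i\<in>I. r $ i) = real (CARD('d) - k) * (\<Sum>j\<in>J. r $ j)"
    and nonempty: "(closed_polygons r :: (complex ^ 'd ^ 'd ^ 'n) set) \<noteq> {}"
    unfolding wall_def weight_cone_def by blast
  have IJ: "I \<inter> J = {}" "I \<union> J = UNIV" using part by (auto simp: bipartition_def)
  \<comment> \<open>Walls lie inside the weight cone, so some closed polygon exists; it serves only
    to bound the side lengths.\<close>
  have le: "r $ i \<le> L" for i
    unfolding L_def using side_length_le nonempty assms(3) by blast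
  \<comment> \<open>Index types are nonempty, so \<open>undefined\<close> stands for an arbitrary
    edge.\<close>
  have L: "L > 0" using le[of undefined] assms(3)[of undefined] by linarith
  have total: "(\<Sum>i\<in>UNIV. r $ i) = (\<Sum>i\<in>I. r $ i) + (\<Sum>j\<in>J. r $ j)"
    using IJ by (metis finite sum.union_disjoint)
  have d: "real (CARD('d) - k) = real CARD('d) - real k" using k assms(2) by simp
  \<comment> \<open>The wall equation and the total length are two linear equations in the partial
    sums over \<open>I\<close> and \<open>J\<close>; solving them shows that both sums become
    integers after division by \<open>L\<close>.\<close>
  have sum_J: "(\<Sum>j\<in>J. r $ j) = L * real k"
    using wall unfolding L_def total d by (simp add: field_simps)
  have sum_I: "(\<Sum>i\<in>I. r $ i) = L * real (CARD('d) - k)"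
    using sum_J total unfolding L_def d by (simp add: field_simps)
  have "CARD('d) - k \<le> CARD('d)" by simp
  \<comment> \<open>The two summands will be the coordinate subspaces of \<open>S\<close> and of its
    complement.\<close>
  then obtain S :: "'d set" where S: "card S = CARD('d) - k"
    using obtain_subset_with_card_n by metis
  have S': "card (- S) = k" using S k assms(2) by (simp add: Compl_eq_Diff_UNIV card_Diff_subset)
  have unit: "0 \<le> r $ i / L \<and> r $ i / L \<le> 1" for i
    using le[of i] L assms(3)[of i] by (metis divide_le_eq_1_pos divide_nonneg_pos less_imp_le)
  have "(\<Sum>i\<in>I. r $ i / L) = real (card S)" "(\<Sum>i\<in>J. r $ i / L) = real (card (- S))"
    using sum_I sum_J L unfolding S S' by (simp_all flip: sum_divide_distrib)
  then obtain x1 x2 :: "'n \<Rightarrow> complex ^ 'd" where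
    x1: "\<And>i. i \<in> I \<Longrightarrow> (norm (x1 i))\<^sup>2 = r $ i / L" "(\<Sum>i\<in>I. rank_one (x1 i)) = coord_proj S" and
    x2: "\<And>i. i \<in> J \<Longrightarrow> (norm (x2 i))\<^sup>2 = r $ i / L" "(\<Sum>i\<in>J. rank_one (x2 i)) = coord_proj (- S)"
    using parseval_frame_exists[of I "\<lambda>i. r $ i / L" S]
      parseval_frame_exists[of J "\<lambda>i. r $ i / L" "- S"] unit by (metis finite)
  define x where "x i = (if i \<in> I then x1 i else x2 i)" for i
  have norm_x: "(norm (x i))\<^sup>2 = r $ i / L" for i
    using x1(1)[of i] x2(1)[of i] IJ by (auto simp: x_def)
  have frame_I: "(\<Sum>i\<in>I. rank_one (x i)) = coord_proj S"
    using x1(2) by (simp add: x_def)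
  have "(\<Sum>i\<in>J. rank_one (x i)) = (\<Sum>i\<in>J. rank_one (x2 i))"
    using IJ by (intro sum.cong) (auto simp: x_def)
  then have frame_J: "(\<Sum>i\<in>J. rank_one (x i)) = coord_proj (- S)"
    using x2(2) by simp
  \<comment> \<open>The squared norm of \<open>x i\<close> is \<open>r $ i / L\<close>, so the
    factor \<open>L\<close> gives the edge length \<open>r $ i\<close> and turns the two
    projections, which add up to the identity, into the required scalar matrix.\<close>
  define e :: "complex ^ 'd ^ 'd ^ 'n" where "e = (\<chi> i. L *\<^sub>R rank_one (x i))"
  have e: "e $ i = L *\<^sub>R rank_one (x i)" for i by (simp add: e_def)
  have "e $ i \<in> orbit (r $ i)" for i
  proof -
    \<comment> \<open>Positive length makes \<open>x i\<close> nonzero, so its normalisation is a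
      unit vector representing the edge.\<close>
    have "x i \<noteq> 0" using norm_x[of i] assms(3)[of i] L by auto
    then have "x i = norm (x i) *\<^sub>R sgn (x i)" by (simp add: sgn_div_norm)
    then have "rank_one (x i) = (norm (x i))\<^sup>2 *\<^sub>R rank_one (sgn (x i))"
      by (metis rank_one_scaleR)
    then have "e $ i = (L * (r $ i / L)) *\<^sub>R rank_one (sgn (x i))"
      by (simp only: e norm_x scaleR_scaleR)
    moreover have "L * (r $ i / L) = r $ i" 
      using L by (metis less_irrefl nonzero_mult_div_cancel_left times_divide_eq_right)
    ultimately have "e $ i = (r $ i) *\<^sub>R rank_one (sgn (x i))" by simp
    then show ?thesis using \<open>x i \<noteq> 0\<close> unfolding orbit_def by (auto simp: norm_sgn)
  qed
  moreover have "(\<Sum>i\<in>UNIV. e $ i) = mat (of_real L)"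
  proof -
    have "(\<Sum>i\<in>UNIV. e $ i) = L *\<^sub>R (\<Sum>i\<in>I \<union> J. rank_one (x i))"
      by (simp only: e IJ scaleR_sum_right)
    also have "\<dots> = L *\<^sub>R (coord_proj S + coord_proj (- S))"
      by (simp only: sum.union_disjoint[OF finite finite IJ(1)] frame_I frame_J)
    also have "\<dots> = mat (of_real L)"
      by (simp only: vec_eq_iff) (simp add: coord_proj_def mat_def scaleR_conv_of_real[where 'a = complex])
    finally show ?thesis .
  qed
  ultimately have "e \<in> closed_polygons r" by (simp add: closed_polygons_def L_def)
  moreover have "decomposable e"
    unfolding decomposable_def
  proof (intro exI conjI)
    show "closed_in {v. \<forall>a. a \<notin> S \<longrightarrow> v $ a = 0} I e"
      by (rule closed_in_coordinate_subspace[OF frame_I e])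
    show "closed_in {v. \<forall>a. a \<notin> - S \<longrightarrow> v $ a = 0} J e"
      by (rule closed_in_coordinate_subspace[OF frame_J e])
    show "vec.dim {v :: complex ^ 'd. \<forall>a. a \<notin> S \<longrightarrow> v $ a = 0} = CARD('d) - k"
      using S by (simp only: dim_substandard_cart)
    show "vec.dim {v :: complex ^ 'd. \<forall>a. a \<notin> - S \<longrightarrow> v $ a = 0} = k"
      using S' by (simp only: dim_substandard_cart)
  qed (use k part assms(2) orthogonal_decomposition_coordinate in auto)
  ultimately show "\<exists>e \<in> (closed_polygons r :: (complex ^ 'd ^ 'd ^ 'n) set). decomposable e"
    by blast
qed

end
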